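(* Let $E$ be a real Banach space, $P\subseteq E$ a normal cone with non-empty interior, $X$ a non-empty set, $\Theta:X\times X\times X\to[1,\infty)$ a function, and $(X,d_\Theta)$ an extended cone $b$-metric space. Then the sequential topology $\sigma$ on $X$ (the family of all sequentially open subsets of $(X,d_\Theta)$) and the topology $\sigma_{d_\Theta}$ induced by $d_\Theta$ coincide.
   Context: Let $E$ be a real Banach space. A cone is a set $P\subseteq E$ that is non-empty, closed, $P\neq\{0\}$, such that $sx+ty\in P$ whenever $x,y\in P$ and $s,t\ge 0$ are real, and such that $x\in P$ and $-x\in P$ imply $x=0$. Write $x\le y$ iff $y-x\in P$, $x<y$ iff $x\le y$ and $x\ne y$, and $x\ll y$ iff $y-x\in\operatorname{int}(P)$. The cone $P$ is normal if there is $N>0$ such that $0\le x\le y$ implies $\|x\|\le N\|y\|$. Given $\Theta:X\times X\times X\to[1,\infty)$, a map $d_\Theta:X\times X\to E$ is an extended cone $b$-metric on $X$, and $(X,d_\Theta)$ an extended cone $b$-metric space, if for all $x,y,z\in X$: (i) $0\le d_\Theta(x,y)$, and $d_\Theta(x,y)=0$ iff $x=y$; (ii) $d_\Theta(x,y)=d_\Theta(y,x)$; (iii) $d_\Theta(x,z)\le\Theta(x,y,z)\,(d_\Theta(x,y)+d_\Theta(y,z))$. A sequence $\{x_n\}$ in $X$ converges to $x\in X$ ($x_n\to x$) if for each $u\gg0$ there is $M\in\mathbb N$ such that $d_\Theta(x_n,x)\ll u$ for all $n\ge M$. A set $U\subseteq X$ is sequentially open if for every $x\in U$ and every sequence $\{x_n\}$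 in $X$ with $x_n\to x$ there is $N_0\in\mathbb N$ such that $x_n\in U$ for all $n>N_0$. For $x\in X$ and $u\gg0$, $B(x,u)=\{y\in X: d_\Theta(x,y)\ll u\}$. The topology $\sigma_{d_\Theta}$ induced by $d_\Theta$ consists of all $U\subseteq X$ such that for every $x\in U$ there is $u\gg0$ with $B(x,u)\subseteq U$. *)

theory Defs
  imports "HOL-Analysis.Analysis"
begin

text \<open>
  The library constants \<open>cone\<close> and \<open>convex_cone\<close> are weaker notions: they require neither
  closedness nor \<open>P \<inter> - P = {0}\<close>.  The order relations of a cone are predicates with the cone
  as a parameter, since a Banach space type carries no canonical order.
\<close>

definition order_cone :: "'e::real_normed_vector set \<Rightarrow> bool" where
  "order_cone P \<longleftrightarrow>
     P \<noteq> {} \<and> closed P \<and> P \<noteq> {0} \<and>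
     (\<forall>x\<in>P. \<forall>y\<in>P. \<forall>s\<ge>0. \<forall>t\<ge>0. s *\<^sub>R x + t *\<^sub>R y \<in> P) \<and>
     (\<forall>x. x \<in> P \<and> - x \<in> P \<longrightarrow> x = 0)"

definition cone_le :: "'e::real_normed_vector set \<Rightarrow> 'e \<Rightarrow> 'e \<Rightarrow> bool" where
  "cone_le P x y \<longleftrightarrow> y - x \<in> P"

definition cone_ll :: "'e::real_normed_vector set \<Rightarrow> 'e \<Rightarrow> 'e \<Rightarrow> bool" where
  "cone_ll P x y \<longleftrightarrow> y - x \<in> interior P"

definition normal_cone :: "'e::real_normed_vector set \<Rightarrow> bool" where
  "normal_cone P \<longleftrightarrow>
     order_cone P \<and>
     (\<exists>N>0. \<forall>x y. cone_le P 0 x \<and> cone_le P x y \<longrightarrow> norm x \<le> N * norm y)"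

definition extended_cone_b_metric ::
  "'e::real_normed_vector set \<Rightarrow> 'a set \<Rightarrow> ('a \<Rightarrow> 'a \<Rightarrow> 'a \<Rightarrow> real) \<Rightarrow> ('a \<Rightarrow> 'a \<Rightarrow> 'e) \<Rightarrow> bool" where
  "extended_cone_b_metric P X \<Theta> d \<longleftrightarrow>
     (\<forall>x\<in>X. \<forall>y\<in>X. cone_le P 0 (d x y) \<and> (d x y = 0 \<longleftrightarrow> x = y)) \<and>
     (\<forall>x\<in>X. \<forall>y\<in>X. d x y = d y x) \<and>
     (\<forall>x\<in>X. \<forall>y\<in>X. \<forall>z\<in>X. cone_le P (d x z) (\<Theta> x y z *\<^sub>R (d x y + d y z)))"

definition cone_converges ::
  "'e::real_normed_vector set \<Rightarrow> ('a \<Rightarrow> 'a \<Rightarrow> 'e) \<Rightarrow> (nat \<Rightarrow> 'a) \<Rightarrow> 'a \<Rightarrow> bool" where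
  "cone_converges P d s x \<longleftrightarrow>
     (\<forall>u. cone_ll P 0 u \<longrightarrow> (\<exists>M. \<forall>n\<ge>M. cone_ll P (d (s n) x) u))"

definition sequentially_open ::
  "'e::real_normed_vector set \<Rightarrow> 'a set \<Rightarrow> ('a \<Rightarrow> 'a \<Rightarrow> 'e) \<Rightarrow> 'a set \<Rightarrow> bool" where
  "sequentially_open P X d U \<longleftrightarrow>
     U \<subseteq> X \<and>
     (\<forall>x\<in>U. \<forall>s. (\<forall>n. s n \<in> X) \<and> cone_converges P d s x \<longrightarrow> (\<exists>N. \<forall>n>N. s n \<in> U))"

definition sequential_topology ::
  "'e::real_normed_vector set \<Rightarrow> 'a set \<Rightarrow> ('a \<Rightarrow> 'a \<Rightarrow> 'e) \<Rightarrow> 'a set set" where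
  "sequential_topology P X d = {U. sequentially_open P X d U}"

definition cone_ball ::
  "'e::real_normed_vector set \<Rightarrow> 'a set \<Rightarrow> ('a \<Rightarrow> 'a \<Rightarrow> 'e) \<Rightarrow> 'a \<Rightarrow> 'e \<Rightarrow> 'a set" where
  "cone_ball P X d x u = {y \<in> X. cone_ll P (d x y) u}"

definition induced_topology ::
  "'e::real_normed_vector set \<Rightarrow> 'a set \<Rightarrow> ('a \<Rightarrow> 'a \<Rightarrow> 'e) \<Rightarrow> 'a set set" where
  "induced_topology P X d =
     {U. U \<subseteq> X \<and> (\<forall>x\<in>U. \<exists>u. cone_ll P 0 u \<and> cone_ball P X d x u \<subseteq> U)}"

end

theory Submission
  imports Defs
begin

text \<open>
  A set is open for either topology exactly when it swallows what comes close to each of its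
  points, and closeness is measured by the vectors \<open>0 \<lless> u\<close>.  The two ways of testing this, by
  sequences and by balls, agree because countably many vectors suffice: for a fixed interior
  point \<open>e\<close> of the cone, every \<open>0 \<lless> u\<close> eventually dominates \<open>(1/(n+1)) e\<close>, since
  \<open>u - (1/(n+1)) e\<close> tends to \<open>u\<close> and the interior is open
  (\<open>eventually_cone_ll_inverse_Suc\<close>).

  Hence if no ball around \<open>x \<in> U\<close> lies inside \<open>U\<close>, choosing a point outside \<open>U\<close> in each ball of
  radius \<open>(1/(n+1)) e\<close> produces a sequence that converges to \<open>x\<close> and avoids \<open>U\<close>, so \<open>U\<close> is not
  sequentially open.  Conversely a convergent sequence enters every ball around its limit.
  Convergence measures \<open>d (s n) x\<close> while balls measure \<open>d x y\<close>; symmetry of \<open>d\<close> matches them.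
\<close>

lemma order_cone_add:
  assumes "order_cone P" "x \<in> P" "y \<in> P"
  shows "x + y \<in> P"
proof -
  have "1 *\<^sub>R x + 1 *\<^sub>R y \<in> P"
    using assms zero_le_one unfolding order_cone_def by blast
  then show ?thesis by simp
qed

lemma order_cone_scaleR:
  assumes "order_cone P" "x \<in> P" "0 \<le> t"
  shows "t *\<^sub>R x \<in> P"
proof -
  have "t *\<^sub>R x + 0 *\<^sub>R x \<in> P"
    using assms order_refl[of "0::real"] unfolding order_cone_def by blast
  then show ?thesis by simp
qed

text \<open>
  Translating by an element of the cone maps the interior to an open subset of the cone.
\<close>

lemma order_cone_interior_add:
  assumes P: "order_cone P" and a: "a \<in> interior P" and b: "b \<in> P"
  shows "a + b \<in> interior P"
proof -
  have "(+) b ` interior P \<subseteq> P"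
    using order_cone_add[OF P b] interior_subset[of P] by blast
  then have "(+) b ` interior P \<subseteq> interior P"
    by (intro interior_maximal open_translation open_interior)
  then show ?thesis
    using a by (auto simp: add.commute)
qed

lemma order_cone_interior_scaleR:
  assumes P: "order_cone P" and a: "a \<in> interior P" and t: "0 < t"
  shows "t *\<^sub>R a \<in> interior P"
proof -
  have "(*\<^sub>R) t ` interior P \<subseteq> P"
    using order_cone_scaleR[OF P] interior_subset[of P] t by force
  then have "(*\<^sub>R) t ` interior P \<subseteq> interior P"
    using t by (intro interior_maximal open_scaling open_interior) auto
  then show ?thesis
    using a by blast
qed

lemma cone_ll_trans:
  assumes "order_cone P" "cone_ll P x y" "cone_ll P y z"
  shows "cone_ll P x z"
proof -
  have "(z - y) + (y - x) \<in> interior P"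
    using assms interior_subset[of P] order_cone_interior_add
    unfolding cone_ll_def by blast
  then show ?thesis
    unfolding cone_ll_def by simp
qed

text \<open>
  For \<open>e\<close> in the interior of the cone, the multiples \<open>(1/(n+1)) e\<close> play the role of the radii
  \<open>1/(n+1)\<close> in a metric space: countably many radii, of which almost all lie below any
  prescribed one.
\<close>

lemma eventually_cone_ll_inverse_Suc:
  assumes "cone_ll P 0 u"
  shows "\<forall>\<^sub>F n in sequentially. cone_ll P (inverse (real (Suc n)) *\<^sub>R e) u"
proof -
  have "(\<lambda>n. u - inverse (real (Suc n)) *\<^sub>R e) \<longlonglongrightarrow> u - 0 *\<^sub>R e"
    by (intro tendsto_intros LIMSEQ_inverse_real_of_nat)
  then show ?thesis
    using assms topological_tendstoD[OF _ open_interior[of P]]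
    unfolding cone_ll_def by fastforce
qed

text \<open>
  If every ball around \<open>x\<close> leaves \<open>U\<close>, points outside \<open>U\<close> chosen from balls of shrinking
  radius \<open>(1/(n+1)) e\<close> form a sequence that refutes sequential openness at \<open>x\<close>.
\<close>

lemma cone_ball_subset_if_sequentially_open:
  assumes P: "order_cone P" and int: "interior P \<noteq> {}"
    and sym: "\<forall>x\<in>X. \<forall>y\<in>X. d x y = d y x"
    and U: "sequentially_open P X d U" and x: "x \<in> U"
  shows "\<exists>u. cone_ll P 0 u \<and> cone_ball P X d x u \<subseteq> U"
proof (rule ccontr)
  assume no_ball: "\<not> ?thesis"
  have "x \<in> X"
    using U x unfolding sequentially_open_def by blast
  obtain e where e: "e \<in> interior P"
    using int by blast
  define u where "u n = inverse (real (Suc n)) *\<^sub>R e" for n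
  have "cone_ll P 0 (u n)" for n
    using order_cone_interior_scaleR[OF P e] unfolding cone_ll_def u_def by simp
  then have "\<forall>n. \<exists>y. y \<in> cone_ball P X d x (u n) \<and> y \<notin> U"
    using no_ball by blast
  then obtain s where s: "\<And>n. s n \<in> cone_ball P X d x (u n)" "\<And>n. s n \<notin> U"
    by metis
  have sX: "s n \<in> X" and near: "cone_ll P (d (s n) x) (u n)" for n
    using s(1)[of n] sym \<open>x \<in> X\<close> unfolding cone_ball_def by auto
  have "cone_converges P d s x"
    unfolding cone_converges_def
  proof (intro allI impI)
    fix v assume "cone_ll P 0 v"
    then obtain M where "\<forall>n\<ge>M. cone_ll P (u n) v"
      using eventually_cone_ll_inverse_Suc[of P v e]
      unfolding u_def eventually_sequentially by blast
    then show "\<exists>M. \<forall>n\<ge>M. cone_ll P (d (s n) x) v"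
      using cone_ll_trans[OF P near] by blast
  qed
  then obtain N where "\<forall>n>N. s n \<in> U"
    using U x sX unfolding sequentially_open_def by blast
  then show False
    using s(2) by blast
qed

lemma sequentially_open_if_cone_balls_subset:
  assumes sym: "\<forall>x\<in>X. \<forall>y\<in>X. d x y = d y x"
    and UX: "U \<subseteq> X"
    and balls: "\<forall>x\<in>U. \<exists>u. cone_ll P 0 u \<and> cone_ball P X d x u \<subseteq> U"
  shows "sequentially_open P X d U"
  unfolding sequentially_open_def
proof (intro conjI ballI allI impI UX)
  fix x s
  assume x: "x \<in> U" and s: "(\<forall>n. s n \<in> X) \<and> cone_converges P d s x"
  obtain u where u: "cone_ll P 0 u" "cone_ball P X d x u \<subseteq> U"
    using balls x by blast
  obtain M where M: "\<forall>n\<ge>M. cone_ll P (d (s n) x) u"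
    using s u(1) unfolding cone_converges_def by blast
  have "s n \<in> cone_ball P X d x u" if "n > M" for n
  proof -
    have "cone_ll P (d (s n) x) u"
      using M that by simp
    moreover have "d (s n) x = d x (s n)"
      using sym s x UX by blast
    ultimately show ?thesis
      using s unfolding cone_ball_def by simp
  qed
  then show "\<exists>N. \<forall>n>N. s n \<in> U"
    using u(2) by blast
qed

theorem proposition3p3:
  fixes P :: "'e::banach set"
    and X :: "'a set"
    and \<Theta> :: "'a \<Rightarrow> 'a \<Rightarrow> 'a \<Rightarrow> real"
    and d :: "'a \<Rightarrow> 'a \<Rightarrow> 'e"
  assumes "normal_cone P"
    and "interior P \<noteq> {}"
    and "X \<noteq> {}"
    and "\<forall>x\<in>X. \<forall>y\<in>X. \<forall>z\<in>X. \<Theta> x y z \<ge> 1"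
    and "extended_cone_b_metric P X \<Theta> d"
  shows "sequential_topology P X d = induced_topology P X d"
proof -
  have P: "order_cone P"
    using assms(1) unfolding normal_cone_def by blast
  have sym: "\<forall>x\<in>X. \<forall>y\<in>X. d x y = d y x"
    using assms(5) unfolding extended_cone_b_metric_def by blast
  have "sequentially_open P X d U \<longleftrightarrow>
      U \<subseteq> X \<and> (\<forall>x\<in>U. \<exists>u. cone_ll P 0 u \<and> cone_ball P X d x u \<subseteq> U)" for U
  proof
    assume U: "sequentially_open P X d U"
    then have "U \<subseteq> X"
      unfolding sequentially_open_def by blast
    then show "U \<subseteq> X \<and> (\<forall>x\<in>U. \<exists>u. cone_ll P 0 u \<and> cone_ball P X d x u \<subseteq> U)"
      using cone_ball_subset_if_sequentially_open[OF P assms(2) sym U] by blast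
  next
    assume "U \<subseteq> X \<and> (\<forall>x\<in>U. \<exists>u. cone_ll P 0 u \<and> cone_ball P X d x u \<subseteq> U)"
    then show "sequentially_open P X d U"
      using sequentially_open_if_cone_balls_subset[OF sym] by blast
  qed
  then show ?thesis
    unfolding sequential_topology_def induced_topology_def by blast
qed

end
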